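(* Let $A,B$ be finite alphabets, $F$ a cellular automaton on $A^{\mathbb{Z}^2}$ and $G$ a cellular automaton on $B^{\mathbb{Z}^2}$. If there exists a sliding block code $\varphi:A^{\mathbb{Z}^2}\to B^{\mathbb{Z}^2}$ such that $\varphi\circ F=G\circ\varphi$, then $$ER(A^{\mathbb{Z}^2},F)\ge ER(B^{\mathbb{Z}^2},G).$$ In particular, topological entropy rate is an invariant for the class of bijective sliding block codes $\varphi:A^{\mathbb{Z}^2}\to B^{\mathbb{Z}^2}$: if such a $\varphi$ with $\varphi\circ F=G\circ\varphi$ is bijective, then $ER(A^{\mathbb{Z}^2},F)=ER(B^{\mathbb{Z}^2},G)$.
   Context: $A^{\mathbb{Z}^2}$ carries the product of discrete topologies (similarly for $B$). The shifts are $\sigma^v(x)_u=x_{u+v}$, $u,v\in\mathbb{Z}^2$. Let $E_n=\{(i,j)\in\mathbb{Z}^2: -n\le i,j\le n\}$. A cellular automaton (CA) $F$ is a continuous self-map of $A^{\mathbb{Z}^2}$ commuting with all shifts; equivalently there are $r\in\mathbb{N}$ and $f:A^{E_r}\to A$ with $F(x)_z=f\big((x_{z+u})_{u\in E_r}\big)$ for all $z$; such an $r$ is called the radius of $F$. A sliding block code $\varphi:A^{\mathbb{Z}^2}\to B^{\mathbb{Z}^2}$ is a continuous map with $\varphi\circ\sigma^v=\sigma^v\circ\varphi$ for all $v\in\mathbb{Z}^2$. For $n\ge r$, where $r$ is the radius of the CA considered, $E'_n=E_n\setminus E_{n-r}$. For a finite open cover $\mathcal{C}$, $\mathcal{C}'_n=\bigvee_{v\in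 E'_n}\sigma^v(\mathcal{C})$. For an open cover $\mathcal{U}$, $H(\mathcal{U})=\ln N(\mathcal{U})$ with $N(\mathcal{U})$ the smallest cardinality of a finite subcover; $h(\mathcal{U},F)=\lim_{N\to\infty}\frac1N H(\bigvee_{i=0}^{N-1}F^{-i}\mathcal{U})$; $ER(\mathcal{C},F)=\limsup_{n\to\infty}\frac1n h(\mathcal{C}'_n,F)$; and $ER(A^{\mathbb{Z}^2},F)=\sup_{\mathcal{C}}ER(\mathcal{C},F)$ over all finite open covers $\mathcal{C}$ of $A^{\mathbb{Z}^2}$ (similarly for $G$ on $B^{\mathbb{Z}^2}$).
   Formalization: The inequality is proved for surjective sliding block codes φ; without surjectivity it fails (A one letter, F the identity, B={0,1}, G the shift σ^(1,0), φ constantly the zero configuration). The bijective claim is as stated. *)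

theory Defs
  imports "HOL-Analysis.Analysis"
begin

text \<open>An alphabet is a type of class \<open>finite\<close>. Addition on \<^typ>\<open>int \<times> int\<close> is
  componentwise.\<close>

type_synonym 'a config = "int \<times> int \<Rightarrow> 'a"

definition config_topology :: "'a config topology" where
  "config_topology = product_topology (\<lambda>_. discrete_topology UNIV) UNIV"

definition shift :: "int \<times> int \<Rightarrow> 'a config \<Rightarrow> 'a config" where
  "shift v x = (\<lambda>u. x (u + v))"

definition sliding_block_code :: "('a config \<Rightarrow> 'b config) \<Rightarrow> bool" where
  "sliding_block_code \<phi> \<longleftrightarrow>
     continuous_map config_topology config_topology \<phi> \<and>
     (\<forall>v. \<phi> \<circ> shift v = shift v \<circ> \<phi>)"

definition cellular_automaton :: "('a config \<Rightarrow> 'a config) \<Rightarrow> bool" where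
  "cellular_automaton F \<longleftrightarrow> sliding_block_code F"

text \<open>The index is an integer so that the square is empty when it is negative.\<close>

definition square :: "int \<Rightarrow> (int \<times> int) set" where
  "square n = {-n..n} \<times> {-n..n}"

text \<open>Restriction to the window makes the local rule a map on window patterns.
  A radius is not unique: every larger number is a radius as well.\<close>

definition is_radius :: "('a config \<Rightarrow> 'a config) \<Rightarrow> nat \<Rightarrow> bool" where
  "is_radius F r \<longleftrightarrow>
     (\<exists>f. \<forall>x z. F x z = f (restrict (\<lambda>u. x (z + u)) (square (int r))))"

definition frame :: "nat \<Rightarrow> nat \<Rightarrow> (int \<times> int) set" where
  "frame r n = square (int n) - square (int n - int r)"

definition open_cover :: "'a config set set \<Rightarrow> bool" where
  "open_cover \<U> \<longleftrightarrow> (\<forall>U\<in>\<U>. openin config_topology U) \<and> \<Union>\<U> = UNIV"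

text \<open>The common refinement of an indexed family of covers; the empty join is the
  trivial cover.\<close>

definition cover_join :: "'i set \<Rightarrow> ('i \<Rightarrow> 'x set set) \<Rightarrow> 'x set set" where
  "cover_join I \<U> = (\<lambda>s. \<Inter>i\<in>I. s i) ` (\<Pi>\<^sub>E i\<in>I. \<U> i)"

definition frame_cover :: "nat \<Rightarrow> nat \<Rightarrow> 'a config set set \<Rightarrow> 'a config set set" where
  "frame_cover r n \<C> = cover_join (frame r n) (\<lambda>v. (\<lambda>U. shift v ` U) ` \<C>)"

definition min_subcover_card :: "'x set set \<Rightarrow> nat" where
  "min_subcover_card \<U> = (LEAST k. \<exists>\<V>. \<V> \<subseteq> \<U> \<and> finite \<V> \<and> \<Union>\<V> = UNIV \<and> card \<V> = k)"

definition cover_entropy :: "'x set set \<Rightarrow> real" where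
  "cover_entropy \<U> = ln (real (min_subcover_card \<U>))"

definition entropy_of_cover_map :: "'x set set \<Rightarrow> ('x \<Rightarrow> 'x) \<Rightarrow> real" where
  "entropy_of_cover_map \<U> F =
     lim (\<lambda>N. cover_entropy (cover_join {..<N} (\<lambda>i. (\<lambda>U. (F ^^ i) -` U) ` \<U>)) / real N)"

text \<open>The argument \<open>r\<close> is the radius with respect to which the frames are formed. Frames with
  \<open>n < r\<close> do not influence the upper limit.\<close>

definition cover_entropy_rate :: "nat \<Rightarrow> 'a config set set \<Rightarrow> ('a config \<Rightarrow> 'a config) \<Rightarrow> ereal" where
  "cover_entropy_rate r \<C> F =
     limsup (\<lambda>n. ereal (entropy_of_cover_map (frame_cover r n \<C>) F / real n))"

definition entropy_rate :: "nat \<Rightarrow> ('a config \<Rightarrow> 'a config) \<Rightarrow> ereal" where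
  "entropy_rate r F = (SUP \<C>\<in>{\<C>. finite \<C> \<and> open_cover \<C>}. cover_entropy_rate r \<C> F)"

end

theory Submission
  imports Defs
begin

text \<open>Pulling covers back along \<open>\<phi>\<close> shows that the entropy rate of \<open>G\<close>, formed with frames of
  width \<open>s\<close>, is at most that of \<open>F\<close> formed with frames of the same width. It remains to replace \<open>s\<close>
  by a radius \<open>r\<close> of \<open>F\<close>. The initial pattern on a square together with the
  history of its frame of width \<open>r\<close> determines the history of the whole square, and the number of
  initial patterns does not depend on time. So the square and its frame carry the same entropy.
  The inverse of a bijective \<open>\<phi>\<close> is again a sliding block code, by compactness.\<close>

subsection \<open>Subadditive sequences\<close>

lemma subadditive_mult:
  fixes a :: "nat \<Rightarrow> real"
  assumes "\<And>m n. a (m + n) \<le> a m + a n"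
  shows "a (q * m + t) \<le> real q * a m + a t"
proof (induction q)
  case (Suc q)
  have "a (Suc q * m + t) \<le> a m + a (q * m + t)"
    using assms[of m "q * m + t"] by (simp add: algebra_simps)
  then show ?case using Suc by (simp add: algebra_simps)
qed simp

text \<open>Fekete's lemma, the limit being the infimum of the quotients. It is needed because
  \<open>lim\<close> in \<open>entropy_of_cover_map\<close> is meaningful only for a convergent
  sequence.\<close>

lemma subadditive_convergent:
  fixes a :: "nat \<Rightarrow> real"
  assumes sub: "\<And>m n. a (m + n) \<le> a m + a n" and nonneg: "\<And>n. 0 \<le> a n"
  shows "convergent (\<lambda>n. a n / real n)"
proof -
  \<comment> \<open>The index 0 is left out: there division by zero gives the value 0, which may lie
    below all other quotients.\<close>
  define L where "L = (INF n\<in>{1..}. a n / real n)"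
  have bdd: "bdd_below ((\<lambda>n. a n / real n) ` {1..})"
    using nonneg by (intro bdd_belowI[of _ 0]) auto
  have lower: "L \<le> a n / real n" if "n \<ge> 1" for n
    unfolding L_def using bdd that by (intro cINF_lower) auto
  have "(\<lambda>n. a n / real n) \<longlonglongrightarrow> L"
  proof (rule LIMSEQ_I)
    fix e :: real assume "e > 0"
    then have "\<exists>m\<in>{1..}. a m / real m < L + e / 2"
      using cINF_less_iff[OF _ bdd, of "L + e / 2"] unfolding L_def by auto
    then obtain m where m: "m \<ge> 1" "a m / real m < L + e / 2" by auto
    \<comment> \<open>Writing n as a multiple of m plus a remainder, \<open>K\<close> bounds the
      contribution of the remainder uniformly in n, so it vanishes after division by n.\<close>
    define K where "K = Max (a ` {..<m})"
    have K: "a t \<le> K" if "t < m" for t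
      unfolding K_def using that by (intro Max_ge) auto
    obtain N where N: "real N > K / (e / 2)" using reals_Archimedean2 by blast
    show "\<exists>N. \<forall>n\<ge>N. norm (a n / real n - L) < e"
    proof (intro exI allI impI)
      fix n assume n: "Suc N \<le> n"
      have n0: "real n > 0" using n by simp
      have "a n = a ((n div m) * m + n mod m)" by simp
      also have "\<dots> \<le> real (n div m) * a m + a (n mod m)"
        using subadditive_mult[OF sub] .
      also have "\<dots> \<le> real n / real m * a m + K"
        using m nonneg[of m] K[of "n mod m"] of_nat_div_le_of_nat[of n m, where ?'a = real]
        by (intro add_mono mult_right_mono) auto
      finally have "a n / real n \<le> (real n / real m * a m + K) / real n"
        using n0 by (simp add: divide_right_mono)
      also have "\<dots> = a m / real m + K / real n"
        using n0 m by (simp add: field_simps)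
      also have "K / real n < e / 2"
      proof -
        have "K < real N * (e / 2)" using N \<open>e > 0\<close> by (simp add: field_simps)
        also have "\<dots> \<le> real n * (e / 2)" using n \<open>e > 0\<close> by (intro mult_right_mono) auto
        finally show ?thesis using n0 by (simp add: field_simps)
      qed
      finally have "a n / real n < L + e" using m by simp
      then show "norm (a n / real n - L) < e" using lower[of n] n by simp
    qed
  qed
  then show ?thesis by (rule convergentI)
qed

subsection \<open>Finite covers and refinement\<close>

text \<open>Counting subcovers is purely combinatorial, so this part works with covers of an
  arbitrary type; topology enters only with the configuration space.\<close>

definition finite_cover :: "'x set set \<Rightarrow> bool" where
  "finite_cover \<U> \<longleftrightarrow> finite \<U> \<and> \<Union>\<U> = UNIV"

definition refines :: "'x set set \<Rightarrow> 'x set set \<Rightarrow> bool" where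
  "refines \<U> \<V> \<longleftrightarrow> (\<forall>U\<in>\<U>. \<exists>V\<in>\<V>. U \<subseteq> V)"

lemma refines_trans:
  assumes "refines \<U> \<V>" "refines \<V> \<W>"
  shows "refines \<U> \<W>"
  unfolding refines_def
proof
  fix U assume "U \<in> \<U>"
  then obtain V where "V \<in> \<V>" "U \<subseteq> V" using assms(1) unfolding refines_def by fast
  moreover from this obtain W where "W \<in> \<W>" "V \<subseteq> W" using assms(2) unfolding refines_def by fast
  ultimately show "\<exists>W\<in>\<W>. U \<subseteq> W" by (meson subset_trans)
qed

lemma refines_vimage:
  assumes "refines \<U> \<V>"
  shows "refines ((-`) f ` \<U>) ((-`) f ` \<V>)"
  unfolding refines_def
proof
  fix S assume "S \<in> (-`) f ` \<U>"
  then obtain U where U: "U \<in> \<U>" "S = f -` U" by blast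
  then obtain V where "V \<in> \<V>" "U \<subseteq> V" using assms unfolding refines_def by fast
  then show "\<exists>T\<in>(-`) f ` \<V>. S \<subseteq> T"
    unfolding U(2) by (intro bexI[of _ "f -` V"] vimage_mono imageI)
qed

lemma finite_cover_vimage:
  assumes "finite_cover \<U>"
  shows "finite_cover ((-`) f ` \<U>)"
proof -
  have "\<Union>((-`) f ` \<U>) = f -` \<Union>\<U>" by (simp only: vimage_Union)
  then show ?thesis using assms unfolding finite_cover_def by simp
qed

text \<open>A finite cover is its own finite subcover, so the \<open>LEAST\<close> in the definition
  is attained.\<close>

lemma min_subcover_card_witness:
  assumes "finite_cover \<U>"
  obtains \<V> where "\<V> \<subseteq> \<U>" "finite \<V>" "\<Union>\<V> = UNIV" "card \<V> = min_subcover_card \<U>"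
proof -
  have "\<exists>k \<V>. \<V> \<subseteq> \<U> \<and> finite \<V> \<and> \<Union>\<V> = UNIV \<and> card \<V> = k"
    using assms unfolding finite_cover_def by blast
  from LeastI_ex[OF this] show ?thesis
    using that unfolding min_subcover_card_def by blast
qed

lemma min_subcover_card_le:
  assumes "\<V> \<subseteq> \<U>" "finite \<V>" "\<Union>\<V> = UNIV"
  shows "min_subcover_card \<U> \<le> card \<V>"
  unfolding min_subcover_card_def by (rule Least_le) (use assms in blast)

text \<open>Types are nonempty, so the empty family never covers. This keeps the logarithm in
  \<open>cover_entropy\<close> away from 0.\<close>

lemma min_subcover_card_pos:
  assumes "finite_cover \<U>"
  shows "min_subcover_card \<U> > 0"
proof -
  obtain \<V> where V: "\<V> \<subseteq> \<U>" "finite \<V>" "\<Union>\<V> = UNIV" "card \<V> = min_subcover_card \<U>"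
    using min_subcover_card_witness[OF assms] .
  then have "\<V> \<noteq> {}" by auto
  then have "card \<V> > 0" using V(2) by (simp add: card_gt_0_iff)
  then show ?thesis by (simp only: V(4))
qed

text \<open>Common core of the comparisons below: \<open>g\<close> sends a smallest subcover to a
  subcover with no more members. It is used with \<open>g\<close> enlarging sets, taking preimages
  and taking images.\<close>

lemma min_subcover_card_map:
  assumes "finite_cover \<U>" and "\<And>U. U \<in> \<U> \<Longrightarrow> g U \<in> \<V>"
    and "\<And>\<W>. \<W> \<subseteq> \<U> \<Longrightarrow> \<Union>\<W> = UNIV \<Longrightarrow> \<Union>(g ` \<W>) = UNIV"
  shows "min_subcover_card \<V> \<le> min_subcover_card \<U>"
proof -
  obtain \<W> where W: "\<W> \<subseteq> \<U>" "finite \<W>" "\<Union>\<W> = UNIV" "card \<W> = min_subcover_card \<U>"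
    using min_subcover_card_witness[OF assms(1)] .
  have "min_subcover_card \<V> \<le> card (g ` \<W>)"
  proof (rule min_subcover_card_le)
    show "g ` \<W> \<subseteq> \<V>" using W(1) assms(2) by blast
    show "finite (g ` \<W>)" using W(2) by (rule finite_imageI)
    show "\<Union>(g ` \<W>) = UNIV" using W(1,3) by (rule assms(3))
  qed
  also have "\<dots> \<le> card \<W>" using W(2) by (rule card_image_le)
  finally show ?thesis using W(4) by simp
qed

lemma min_subcover_card_refines:
  assumes "finite_cover \<U>" "refines \<U> \<V>"
  shows "min_subcover_card \<V> \<le> min_subcover_card \<U>"
proof -
  have "\<forall>U\<in>\<U>. \<exists>V. V \<in> \<V> \<and> U \<subseteq> V"
    using assms(2) unfolding refines_def by blast
  from bchoice[OF this] obtain g where g: "\<forall>U\<in>\<U>. g U \<in> \<V> \<and> U \<subseteq> g U" ..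
  show ?thesis
    using assms(1)
  proof (rule min_subcover_card_map[of _ g])
    fix \<W> assume W: "\<W> \<subseteq> \<U>" "\<Union>\<W> = UNIV"
    then have "\<Union>\<W> \<subseteq> \<Union>(g ` \<W>)" using g by blast
    then show "\<Union>(g ` \<W>) = UNIV" using W(2) by blast
  qed (use g in blast)
qed

lemma min_subcover_card_vimage_le:
  assumes "finite_cover \<U>"
  shows "min_subcover_card ((-`) f ` \<U>) \<le> min_subcover_card \<U>"
  using assms
proof (rule min_subcover_card_map[of _ "(-`) f"])
  show "\<Union>((-`) f ` \<W>) = UNIV" if "\<Union>\<W> = UNIV" for \<W>
    using that by (metis vimage_Union vimage_UNIV)
qed (rule imageI)

text \<open>For surjective \<open>f\<close> the image of the preimage of U is U again, so subcovers
  of the pulled-back cover can be pushed forward without gaining members.\<close>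

lemma min_subcover_card_vimage:
  assumes "finite_cover \<U>" "surj f"
  shows "min_subcover_card ((-`) f ` \<U>) = min_subcover_card \<U>"
proof (rule antisym)
  show "min_subcover_card \<U> \<le> min_subcover_card ((-`) f ` \<U>)"
    using finite_cover_vimage[OF assms(1)]
  proof (rule min_subcover_card_map[of _ "(`) f"])
    show "f ` U \<in> \<U>" if "U \<in> (-`) f ` \<U>" for U
      using that assms(2) by (auto simp: surj_image_vimage_eq)
    show "\<Union>((`) f ` \<W>) = UNIV" if "\<Union>\<W> = UNIV" for \<W>
      using that assms(2) by (simp flip: image_Union)
  qed
qed (rule min_subcover_card_vimage_le[OF assms(1)])

text \<open>Intersect the members of two smallest subcovers pairwise. Asking only that each
  intersection fit into some member of \<W> makes the bound apply to any cover coarser than the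
  join.\<close>

lemma min_subcover_card_mult:
  assumes "finite_cover \<U>" "finite_cover \<V>"
    and "\<And>U V. U \<in> \<U> \<Longrightarrow> V \<in> \<V> \<Longrightarrow> \<exists>W\<in>\<W>. U \<inter> V \<subseteq> W"
  shows "min_subcover_card \<W> \<le> min_subcover_card \<U> * min_subcover_card \<V>"
proof -
  obtain \<U>' where U: "\<U>' \<subseteq> \<U>" "finite \<U>'" "\<Union>\<U>' = UNIV" "card \<U>' = min_subcover_card \<U>"
    using min_subcover_card_witness[OF assms(1)] .
  obtain \<V>' where V: "\<V>' \<subseteq> \<V>" "finite \<V>'" "\<Union>\<V>' = UNIV" "card \<V>' = min_subcover_card \<V>"
    using min_subcover_card_witness[OF assms(2)] .
  have "\<forall>p\<in>\<U> \<times> \<V>. \<exists>W. W \<in> \<W> \<and> fst p \<inter> snd p \<subseteq> W"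
    using assms(3) by (auto simp: Bex_def)
  from bchoice[OF this] obtain g where g: "\<forall>p\<in>\<U> \<times> \<V>. g p \<in> \<W> \<and> fst p \<inter> snd p \<subseteq> g p" ..
  have sub: "\<U>' \<times> \<V>' \<subseteq> \<U> \<times> \<V>" using U(1) V(1) by (rule Sigma_mono)
  have "min_subcover_card \<W> \<le> card (g ` (\<U>' \<times> \<V>'))"
  proof (rule min_subcover_card_le)
    show "g ` (\<U>' \<times> \<V>') \<subseteq> \<W>" using g sub by (meson image_subsetI subsetD)
    show "finite (g ` (\<U>' \<times> \<V>'))" using U(2) V(2) by simp
    have "x \<in> \<Union>(g ` (\<U>' \<times> \<V>'))" for x
    proof -
      obtain A where A: "A \<in> \<U>'" "x \<in> A" using U(3) by (metis UNIV_I UnionE)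
      obtain B where B: "B \<in> \<V>'" "x \<in> B" using V(3) by (metis UNIV_I UnionE)
      have "(A, B) \<in> \<U>' \<times> \<V>'" using A(1) B(1) by simp
      moreover from this have "A \<inter> B \<subseteq> g (A, B)" using g sub by fastforce
      ultimately show ?thesis using A(2) B(2) by blast
    qed
    then show "\<Union>(g ` (\<U>' \<times> \<V>')) = UNIV" by (simp add: set_eq_iff)
  qed
  also have "\<dots> \<le> card (\<U>' \<times> \<V>')" using U(2) V(2) by (intro card_image_le) simp
  finally show ?thesis using U(4) V(4) by (simp only: card_cartesian_product)
qed

lemma cover_entropy_nonneg: "finite_cover \<U> \<Longrightarrow> 0 \<le> cover_entropy \<U>"
  using min_subcover_card_pos[of \<U>] unfolding cover_entropy_def by simp

lemma cover_entropy_mono: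
  assumes "finite_cover \<U>" "finite_cover \<V>" "refines \<U> \<V>"
  shows "cover_entropy \<V> \<le> cover_entropy \<U>"
  using min_subcover_card_refines[OF assms(1,3)] min_subcover_card_pos[OF assms(2)]
  unfolding cover_entropy_def by simp

lemma cover_entropy_add:
  assumes "finite_cover \<U>" "finite_cover \<V>" "finite_cover \<W>"
    and "\<And>U V. U \<in> \<U> \<Longrightarrow> V \<in> \<V> \<Longrightarrow> \<exists>W\<in>\<W>. U \<inter> V \<subseteq> W"
  shows "cover_entropy \<W> \<le> cover_entropy \<U> + cover_entropy \<V>"
proof -
  have "real (min_subcover_card \<W>) \<le> real (min_subcover_card \<U>) * real (min_subcover_card \<V>)"
    using min_subcover_card_mult[OF assms(1,2,4)] by (metis of_nat_le_iff of_nat_mult)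
  then show ?thesis
    using assms(1-3)[THEN min_subcover_card_pos] unfolding cover_entropy_def
    by (simp flip: ln_mult_pos)
qed

subsection \<open>Joins of covers\<close>

lemma cover_join_memI:
  assumes "\<And>i. i \<in> I \<Longrightarrow> s i \<in> \<U> i"
  shows "(\<Inter>i\<in>I. s i) \<in> cover_join I \<U>"
  unfolding cover_join_def
  using assms by (intro image_eqI[of _ _ "restrict s I"]) auto

lemma cover_join_memE:
  assumes "S \<in> cover_join I \<U>"
  obtains s where "\<forall>i\<in>I. s i \<in> \<U> i" "S = (\<Inter>i\<in>I. s i)"
proof -
  obtain s where s: "s \<in> (\<Pi>\<^sub>E i\<in>I. \<U> i)" "S = (\<Inter>i\<in>I. s i)"
    using assms unfolding cover_join_def by (rule imageE)
  then have "\<forall>i\<in>I. s i \<in> \<U> i" by (simp add: PiE_mem)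
  then show ?thesis using s(2) by (rule that)
qed

lemma finite_cover_cover_join:
  assumes "finite I" "\<And>i. i \<in> I \<Longrightarrow> finite_cover (\<U> i)"
  shows "finite_cover (cover_join I \<U>)"
proof -
  have "x \<in> \<Union>(cover_join I \<U>)" for x
  proof -
    have "\<forall>i\<in>I. \<exists>S. S \<in> \<U> i \<and> x \<in> S"
      using assms(2) unfolding finite_cover_def by (metis UNIV_I UnionE)
    from bchoice[OF this] obtain s where s: "\<forall>i\<in>I. s i \<in> \<U> i \<and> x \<in> s i" ..
    then have "(\<Inter>i\<in>I. s i) \<in> cover_join I \<U>" by (intro cover_join_memI) simp
    then show ?thesis by (rule UnionI) (use s in simp)
  qed
  moreover have "finite (cover_join I \<U>)"
    using assms unfolding cover_join_def finite_cover_def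
    by (intro finite_imageI finite_PiE) auto
  ultimately show ?thesis unfolding finite_cover_def by (simp add: set_eq_iff)
qed

lemma refines_cover_join:
  assumes "\<And>i. i \<in> I \<Longrightarrow> refines (\<U> i) (\<V> i)"
  shows "refines (cover_join I \<U>) (cover_join I \<V>)"
  unfolding refines_def
proof
  fix S assume "S \<in> cover_join I \<U>"
  then obtain s where s: "\<forall>i\<in>I. s i \<in> \<U> i" "S = (\<Inter>i\<in>I. s i)"
    by (rule cover_join_memE)
  have "\<forall>i\<in>I. \<exists>T. T \<in> \<V> i \<and> s i \<subseteq> T"
    using assms s(1) unfolding refines_def Bex_def by simp
  from bchoice[OF this] obtain t where t: "\<forall>i\<in>I. t i \<in> \<V> i \<and> s i \<subseteq> t i" ..
  then have "(\<Inter>i\<in>I. t i) \<in> cover_join I \<V>" by (intro cover_join_memI) simp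
  moreover have "S \<subseteq> (\<Inter>i\<in>I. t i)" unfolding s(2) using t by (intro INF_superset_mono[OF subset_refl]) simp
  ultimately show "\<exists>T\<in>cover_join I \<V>. S \<subseteq> T" by blast
qed

lemma vimage_cover_join: "(-`) f ` cover_join I \<U> = cover_join I (\<lambda>i. (-`) f ` \<U> i)"
proof (intro equalityI subsetI)
  fix S assume "S \<in> (-`) f ` cover_join I \<U>"
  then obtain S' where S': "S' \<in> cover_join I \<U>" "S = f -` S'" by blast
  obtain s where s: "\<forall>i\<in>I. s i \<in> \<U> i" "S' = (\<Inter>i\<in>I. s i)"
    using S'(1) by (rule cover_join_memE)
  have "S = (\<Inter>i\<in>I. f -` s i)" by (simp only: S'(2) s(2) vimage_INT)
  then show "S \<in> cover_join I (\<lambda>i. (-`) f ` \<U> i)"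
    using cover_join_memI[of I "\<lambda>i. f -` s i"] s(1) by simp
next
  fix S assume "S \<in> cover_join I (\<lambda>i. (-`) f ` \<U> i)"
  then obtain t where t: "\<forall>i\<in>I. t i \<in> (-`) f ` \<U> i" "S = (\<Inter>i\<in>I. t i)"
    by (rule cover_join_memE)
  have "\<forall>i\<in>I. \<exists>A. A \<in> \<U> i \<and> t i = f -` A"
    using t(1) unfolding image_iff Bex_def .
  from bchoice[OF this] obtain s where s: "\<forall>i\<in>I. s i \<in> \<U> i \<and> t i = f -` s i" ..
  then have "S = f -` (\<Inter>i\<in>I. s i)" by (simp add: t(2) vimage_INT)
  moreover have "(\<Inter>i\<in>I. s i) \<in> cover_join I \<U>" using s by (intro cover_join_memI) simp
  ultimately show "S \<in> (-`) f ` cover_join I \<U>" by blast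
qed

subsection \<open>Entropy of a map relative to a cover\<close>

abbreviation orbit_join :: "'x set set \<Rightarrow> ('x \<Rightarrow> 'x) \<Rightarrow> nat \<Rightarrow> 'x set set" where
  "orbit_join \<U> F N \<equiv> cover_join {..<N} (\<lambda>i. (\<lambda>U. (F ^^ i) -` U) ` \<U>)"

lemma finite_cover_orbit_join: "finite_cover \<U> \<Longrightarrow> finite_cover (orbit_join \<U> F N)"
  by (intro finite_cover_cover_join finite_cover_vimage) auto

text \<open>The orbit join over the times M, ..., M + N - 1 is the preimage under
  \<open>F ^^ M\<close> of the join over the first N times.\<close>

lemma cover_entropy_orbit_join_add:
  assumes "finite_cover \<U>"
  shows "cover_entropy (orbit_join \<U> F (M + N))
    \<le> cover_entropy (orbit_join \<U> F M) + cover_entropy (orbit_join \<U> F N)"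
proof -
  let ?V = "(-`) (F ^^ M) ` orbit_join \<U> F N"
  have fin: "finite_cover (orbit_join \<U> F K)" for K
    using assms by (rule finite_cover_orbit_join)
  have "cover_entropy (orbit_join \<U> F (M + N)) \<le> cover_entropy (orbit_join \<U> F M) + cover_entropy ?V"
  proof (rule cover_entropy_add)
    fix S T assume S: "S \<in> orbit_join \<U> F M" and T: "T \<in> ?V"
    from T obtain T' where T': "T = (F ^^ M) -` T'" "T' \<in> orbit_join \<U> F N"
      by (rule imageE)
    obtain s where s: "\<forall>i\<in>{..<M}. s i \<in> (-`) (F ^^ i) ` \<U>" "S = (\<Inter>i\<in>{..<M}. s i)"
      using S by (rule cover_join_memE)
    obtain t where t: "\<forall>i\<in>{..<N}. t i \<in> (-`) (F ^^ i) ` \<U>" "T' = (\<Inter>i\<in>{..<N}. t i)"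
      using T'(2) by (rule cover_join_memE)
    \<comment> \<open>The choices for the two time blocks are concatenated, the second one being
      moved to start at time M.\<close>
    define w where "w i = (if i < M then s i else (F ^^ M) -` t (i - M))" for i
    have "w i \<in> (-`) (F ^^ i) ` \<U>" if "i < M + N" for i
    proof (cases "i < M")
      case False
      then have "i - M \<in> {..<N}" using \<open>i < M + N\<close> by simp
      with t(1) have "t (i - M) \<in> (-`) (F ^^ (i - M)) ` \<U>" by (rule bspec)
      then obtain U where U: "t (i - M) = (F ^^ (i - M)) -` U" "U \<in> \<U>"
        by (rule imageE)
      have "F ^^ i = (F ^^ (i - M)) \<circ> (F ^^ M)"
        using False by (simp flip: funpow_add)
      then have "w i = (F ^^ i) -` U" using False U(1) by (simp add: w_def vimage_comp)
      then show ?thesis using U(2) by (rule image_eqI)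
    qed (use s(1) in \<open>simp add: w_def\<close>)
    then have "(\<Inter>i\<in>{..<M + N}. w i) \<in> orbit_join \<U> F (M + N)"
      by (intro cover_join_memI) auto
    moreover have "S \<inter> T \<subseteq> (\<Inter>i\<in>{..<M + N}. w i)"
    proof (rule INT_greatest)
      fix i assume "i \<in> {..<M + N}"
      then show "S \<inter> T \<subseteq> w i"
        by (cases "i < M") (auto simp: s(2) t(2) T'(1) w_def)
    qed
    ultimately show "\<exists>W\<in>orbit_join \<U> F (M + N). S \<inter> T \<subseteq> W" by (rule bexI[rotated])
  qed (use fin finite_cover_vimage in auto)
  \<comment> \<open>\<open>F\<close> may fail to be surjective, so pulling back may lower the count;
    subadditivity asks only for this direction.\<close>
  moreover have "cover_entropy ?V \<le> cover_entropy (orbit_join \<U> F N)"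
    using min_subcover_card_vimage_le[OF fin, of "F ^^ M" N]
      min_subcover_card_pos[OF finite_cover_vimage[OF fin], of "F ^^ M" N]
    unfolding cover_entropy_def by simp
  ultimately show ?thesis by linarith
qed

lemma entropy_of_cover_map_LIMSEQ:
  assumes "finite_cover \<U>"
  shows "(\<lambda>N. cover_entropy (orbit_join \<U> F N) / real N) \<longlonglongrightarrow> entropy_of_cover_map \<U> F"
proof -
  have "convergent (\<lambda>N. cover_entropy (orbit_join \<U> F N) / real N)"
    using cover_entropy_orbit_join_add[OF assms]
      cover_entropy_nonneg[OF finite_cover_orbit_join[OF assms]]
    by (intro subadditive_convergent)
  then show ?thesis unfolding entropy_of_cover_map_def convergent_LIMSEQ_iff .
qed

text \<open>The constant \<open>c\<close> does not depend on the time N, so it disappears after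
  division by N. This is what makes the number of initial patterns negligible.\<close>

lemma entropy_of_cover_map_le:
  assumes "finite_cover \<U>" "finite_cover \<V>"
    and "\<And>N. cover_entropy (orbit_join \<V> F N) \<le> c + cover_entropy (orbit_join \<U> F N)"
  shows "entropy_of_cover_map \<V> F \<le> entropy_of_cover_map \<U> F"
proof (rule LIMSEQ_le)
  show "(\<lambda>N. cover_entropy (orbit_join \<V> F N) / real N) \<longlonglongrightarrow> entropy_of_cover_map \<V> F"
    using assms(2) by (rule entropy_of_cover_map_LIMSEQ)
  show "(\<lambda>N. c / real N + cover_entropy (orbit_join \<U> F N) / real N) \<longlonglongrightarrow> entropy_of_cover_map \<U> F"
    using tendsto_add[OF lim_const_over_n[of c] entropy_of_cover_map_LIMSEQ[OF assms(1)]]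
    by simp
  show "\<exists>M. \<forall>N\<ge>M. cover_entropy (orbit_join \<V> F N) / real N
      \<le> c / real N + cover_entropy (orbit_join \<U> F N) / real N"
    using assms(3) by (auto intro!: divide_right_mono simp flip: add_divide_distrib)
qed

lemma entropy_of_cover_map_mono:
  assumes "finite_cover \<U>" "finite_cover \<V>" "refines \<U> \<V>"
  shows "entropy_of_cover_map \<V> F \<le> entropy_of_cover_map \<U> F"
proof (rule entropy_of_cover_map_le[where c = 0])
  show "cover_entropy (orbit_join \<V> F N) \<le> 0 + cover_entropy (orbit_join \<U> F N)" for N
    using assms by (simp add: cover_entropy_mono finite_cover_orbit_join refines_cover_join refines_vimage)
qed (use assms in auto)

text \<open>The intertwining relation passes to all iterates, so the whole orbit join for
  \<open>F\<close> is the preimage of the one for \<open>G\<close>; surjectivity then preserves the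
  counts.\<close>

lemma entropy_of_cover_map_vimage:
  assumes "finite_cover \<U>" "surj \<phi>" "\<phi> \<circ> F = G \<circ> \<phi>"
  shows "entropy_of_cover_map ((-`) \<phi> ` \<U>) F = entropy_of_cover_map \<U> G"
proof -
  have "\<phi> ((F ^^ i) x) = (G ^^ i) (\<phi> x)" for i x
    using assms(3) by (induction i) (simp_all add: fun_eq_iff)
  then have funpow: "\<phi> \<circ> (F ^^ i) = (G ^^ i) \<circ> \<phi>" for i by auto
  have "orbit_join ((-`) \<phi> ` \<U>) F N = (-`) \<phi> ` orbit_join \<U> G N" for N
    by (simp add: vimage_cover_join image_image vimage_comp funpow)
  then have "cover_entropy (orbit_join ((-`) \<phi> ` \<U>) F N) = cover_entropy (orbit_join \<U> G N)" for N
    unfolding cover_entropy_def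
    using min_subcover_card_vimage[OF finite_cover_orbit_join[OF assms(1)] assms(2)] by simp
  then show ?thesis unfolding entropy_of_cover_map_def by simp
qed

subsection \<open>Frames\<close>

lemma finite_frame: "finite (frame r n)"
  unfolding frame_def square_def by simp

text \<open>Take for v the negative of the point of \<open>square n\<close> nearest to u, found by
  clamping each coordinate. The sign is negative because the cover shifted by v reads the window
  \<open>square k\<close> translated by -v.\<close>

lemma frame_add_square:
  assumes "u \<in> frame r (n + k)"
  shows "\<exists>v\<in>frame r n. u + v \<in> square (int k)"
proof -
  define clamp where "clamp i = - max (- int n) (min (int n) i)" for i
  have "(clamp (fst u), clamp (snd u)) \<in> frame r n"
    using assms unfolding frame_def square_def clamp_def
    by (cases u) (auto simp: max_def min_def)
  moreover have "u + (clamp (fst u), clamp (snd u)) \<in> square (int k)"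
    using assms unfolding frame_def square_def clamp_def
    by (cases u) (auto simp: max_def min_def)
  ultimately show ?thesis by blast
qed

text \<open>Shifts are invertible. Turning images into preimages makes the preimage lemmas available
  for frame covers.\<close>

lemma shift_image_eq_vimage: "shift v ` U = shift (- v) -` U"
proof -
  have "shift v (shift (- v) x) = x" "shift (- v) (shift v x) = x" for x :: "'a config"
    unfolding shift_def by simp_all
  then show ?thesis by (auto simp: image_iff) metis
qed

lemma frame_cover_eq_vimage:
  "frame_cover r n \<C> = cover_join (frame r n) (\<lambda>v. (-`) (shift (- v)) ` \<C>)"
  unfolding frame_cover_def by (simp add: shift_image_eq_vimage)

lemma finite_cover_frame_cover: "finite_cover \<C> \<Longrightarrow> finite_cover (frame_cover r n \<C>)"
  unfolding frame_cover_eq_vimage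
  by (intro finite_cover_cover_join finite_frame finite_cover_vimage)

lemma refines_frame_cover: "refines \<C> \<D> \<Longrightarrow> refines (frame_cover r n \<C>) (frame_cover r n \<D>)"
  unfolding frame_cover_eq_vimage by (intro refines_cover_join refines_vimage)

lemma vimage_frame_cover:
  assumes "\<And>v. \<phi> \<circ> shift v = shift v \<circ> \<phi>"
  shows "frame_cover r n ((-`) \<phi> ` \<C>) = (-`) \<phi> ` frame_cover r n \<C>"
  by (simp add: frame_cover_eq_vimage vimage_cover_join image_image vimage_comp assms)

subsection \<open>Cylinder partitions\<close>

text \<open>A pattern on J is represented by any configuration extending it, so many
  \<open>x\<close> give the same cylinder.\<close>

definition cylinder :: "(int \<times> int) set \<Rightarrow> 'a config \<Rightarrow> 'a config set" where
  "cylinder J x = {y. \<forall>u\<in>J. y u = x u}"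

abbreviation cylinders :: "(int \<times> int) set \<Rightarrow> 'a config set set" where
  "cylinders J \<equiv> range (cylinder J)"

lemma mem_cylinder: "y \<in> cylinder J x \<longleftrightarrow> (\<forall>u\<in>J. y u = x u)"
  unfolding cylinder_def by simp

lemma refines_cylindersI:
  assumes "\<And>U x y u. U \<in> \<U> \<Longrightarrow> x \<in> U \<Longrightarrow> y \<in> U \<Longrightarrow> u \<in> J \<Longrightarrow> x u = y u"
  shows "refines \<U> (cylinders J)"
  unfolding refines_def
proof
  fix U assume U: "U \<in> \<U>"
  \<comment> \<open>If \<open>U\<close> is empty, \<open>x\<close> is arbitrary, and every cylinder
    contains \<open>U\<close>.\<close>
  define x where "x = (SOME x. x \<in> U)"
  have "y \<in> cylinder J x" if "y \<in> U" for y
  proof -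
    have "x \<in> U" unfolding x_def using that by (rule someI[where P = "\<lambda>x. x \<in> U"])
    then show ?thesis unfolding mem_cylinder using assms[OF U that] by metis
  qed
  then have "U \<subseteq> cylinder J x" by (rule subsetI)
  then show "\<exists>V\<in>cylinders J. U \<subseteq> V" by (rule bexI) (rule rangeI)
qed

lemma Union_cylinders: "\<Union>(cylinders J) = UNIV"
proof -
  have "x \<in> cylinder J x" for x :: "'a config" by (simp add: mem_cylinder)
  then show ?thesis by (simp add: set_eq_iff) metis
qed

text \<open>A cylinder depends only on the restriction of its configuration to J, and a finite
  alphabet leaves finitely many such restrictions.\<close>

lemma finite_cover_cylinders:
  assumes "finite J"
  shows "finite_cover (cylinders J :: 'a::finite config set set)"
proof -
  have "cylinders J \<subseteq> cylinder J ` (J \<rightarrow>\<^sub>E (UNIV :: 'a set))"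
  proof (rule image_subsetI)
    fix x :: "'a config"
    have "cylinder J x = cylinder J (restrict x J)" unfolding cylinder_def by simp
    then show "cylinder J x \<in> cylinder J ` (J \<rightarrow>\<^sub>E UNIV)" by (rule image_eqI[where x = "restrict x J"]) simp
  qed
  moreover have "finite (J \<rightarrow>\<^sub>E (UNIV :: 'a set))" using assms by (intro finite_PiE) simp_all
  ultimately have "finite (cylinders J :: 'a config set set)"
    by (meson finite_imageI finite_subset)
  then show ?thesis unfolding finite_cover_def using Union_cylinders by simp
qed

text \<open>Windows of size k translated by points of the frame stay inside the square of size n +
  k.\<close>

lemma cylinders_square_refines_frame_cover:
  "refines (cylinders (square (int (n + k)))) (frame_cover r n (cylinders (square (int k))))"
  unfolding refines_def
proof
  fix S :: "'a config set" assume "S \<in> cylinders (square (int (n + k)))"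
  then obtain x where S: "S = cylinder (square (int (n + k))) x" by (rule rangeE)
  define t where "t v = shift (- v) -` cylinder (square (int k)) (shift (- v) x)" for v
  have "(\<Inter>v\<in>frame r n. t v) \<in> frame_cover r n (cylinders (square (int k)))"
    unfolding frame_cover_eq_vimage t_def by (intro cover_join_memI imageI rangeI)
  moreover have "S \<subseteq> (\<Inter>v\<in>frame r n. t v)"
  proof (rule INT_greatest)
    fix v assume "v \<in> frame r n"
    then have "u - v \<in> square (int (n + k))" if "u \<in> square (int k)" for u
      using that unfolding frame_def square_def by (cases u; cases v) auto
    then show "S \<subseteq> t v" unfolding S t_def by (auto simp: mem_cylinder shift_def)
  qed
  ultimately show "\<exists>T\<in>frame_cover r n (cylinders (square (int k))). S \<subseteq> T"
    by (rule bexI[rotated])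
qed

text \<open>By \<open>frame_add_square\<close>, the windows of size k translated along the frame at
  n together cover the frame at n + k, so one member of the frame cover fixes all symbols
  there.\<close>

lemma frame_cover_refines_cylinders_frame:
  "refines (frame_cover r n (cylinders (square (int k)))) (cylinders (frame r (n + k)))"
proof (rule refines_cylindersI)
  fix S :: "'a config set" and x y u
  assume S: "S \<in> frame_cover r n (cylinders (square (int k)))"
    and x: "x \<in> S" and y: "y \<in> S" and u: "u \<in> frame r (n + k)"
  obtain v where v: "v \<in> frame r n" "u + v \<in> square (int k)"
    using frame_add_square[OF u] by (rule bexE)
  obtain s where s: "\<forall>v\<in>frame r n. s v \<in> (-`) (shift (- v)) ` cylinders (square (int k))"
      "S = (\<Inter>v\<in>frame r n. s v)"
    using S unfolding frame_cover_eq_vimage by (rule cover_join_memE)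
  obtain z where z: "s v = shift (- v) -` cylinder (square (int k)) z"
    using bspec[OF s(1) v(1)] by (metis imageE)
  have "x \<in> s v" "y \<in> s v" using x y v(1) unfolding s(2) by simp_all
  then have "shift (- v) x (u + v) = shift (- v) y (u + v)"
    using v(2) by (simp add: z mem_cylinder)
  then show "x u = y u" by (simp add: shift_def)
qed

subsection \<open>The configuration space\<close>

lemma topspace_config_topology [simp]: "topspace config_topology = UNIV"
  unfolding config_topology_def by simp

lemma compact_space_config_topology: "compact_space (config_topology :: 'a::finite config topology)"
  unfolding config_topology_def by (simp add: compact_space_product_topology compact_space_discrete_topology)

lemma Hausdorff_space_config_topology: "Hausdorff_space config_topology"
  unfolding config_topology_def by (simp add: Hausdorff_space_product_topology)

lemma openin_cylinder:
  assumes "finite J"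
  shows "openin config_topology (cylinder J x)"
proof -
  have "cylinder J x = (\<Pi>\<^sub>E u\<in>UNIV. if u \<in> J then {x u} else UNIV)"
    unfolding cylinder_def by (auto simp: PiE_UNIV_domain Pi_iff split: if_splits)
  moreover have "finite {u. (if u \<in> J then {x u} else UNIV) \<noteq> UNIV}"
    using assms by (rule finite_subset[rotated]) auto
  ultimately show ?thesis
    unfolding config_topology_def by (simp add: product_topology_basis)
qed

lemma open_cover_cylinders: "finite J \<Longrightarrow> open_cover (cylinders J)"
  unfolding open_cover_def by (intro conjI Union_cylinders) (auto intro: openin_cylinder)

lemma cylinder_in_open:
  assumes "openin config_topology U" "x \<in> U"
  shows "\<exists>J. finite J \<and> cylinder J x \<subseteq> U"
proof -
  obtain X where X: "x \<in> (\<Pi>\<^sub>E u\<in>UNIV. X u)" "finite {u. X u \<noteq> UNIV}" "(\<Pi>\<^sub>E u\<in>UNIV. X u) \<subseteq> U"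
    using product_topology_open_contains_basis[OF assms(1)[unfolded config_topology_def] assms(2)]
    by auto
  have "y u \<in> X u" if "y \<in> cylinder {u. X u \<noteq> UNIV} x" for y u
  proof (cases "X u = UNIV")
    case False
    then have "y u = x u" using that unfolding mem_cylinder by blast
    moreover have "x u \<in> X u" using X(1) by (rule PiE_mem) simp
    ultimately show ?thesis by (rule ssubst)
  qed simp
  then have "cylinder {u. X u \<noteq> UNIV} x \<subseteq> (\<Pi>\<^sub>E u\<in>UNIV. X u)"
    by (simp add: PiE_UNIV_domain Pi_iff subset_iff)
  then show ?thesis using X(2,3) by (meson subset_trans)
qed

lemma finite_subset_square:
  assumes "finite J"
  obtains k where "J \<subseteq> square (int k)"
proof -
  define h where "h u = nat (max \<bar>fst u\<bar> \<bar>snd u\<bar>)" for u :: "int \<times> int"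
  have "J \<subseteq> square (int (Max (h ` J)))"
  proof
    fix u assume "u \<in> J"
    then have "h u \<le> Max (h ` J)" using assms by simp
    then show "u \<in> square (int (Max (h ` J)))"
      unfolding h_def square_def by (cases u) (auto simp: abs_le_iff)
  qed
  then show ?thesis by (rule that)
qed

text \<open>A Lebesgue number argument: each point has a cylinder inside a member of the cover,
  finitely many of these suffice by compactness, and one square contains all coordinates they
  constrain.\<close>

lemma cylinders_refine_open_cover:
  fixes \<C> :: "'a::finite config set set"
  assumes "open_cover \<C>"
  obtains k where "refines (cylinders (square (int k))) \<C>"
proof -
  have "\<exists>J. finite J \<and> (\<exists>U\<in>\<C>. cylinder J x \<subseteq> U)" for x
  proof -
    have "\<Union>\<C> = UNIV" using assms unfolding open_cover_def by simp
    then obtain U where "U \<in> \<C>" "x \<in> U" by (metis UNIV_I UnionE)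
    then show ?thesis using assms cylinder_in_open[of U x] unfolding open_cover_def by metis
  qed
  then obtain J where J: "\<And>x. finite (J x)" "\<And>x. \<exists>U\<in>\<C>. cylinder (J x) x \<subseteq> U"
    by metis
  define \<D> where "\<D> = range (\<lambda>x. cylinder (J x) x)"
  have "openin config_topology V" if "V \<in> \<D>" for V
    using that unfolding \<D>_def by (rule rangeE) (simp add: openin_cylinder J(1))
  moreover have "x \<in> \<Union>\<D>" for x
    unfolding \<D>_def by (rule UN_I[of x]) (simp_all add: mem_cylinder)
  then have "UNIV \<subseteq> \<Union>\<D>" by (rule subsetI)
  ultimately obtain \<F> where F: "finite \<F>" "\<F> \<subseteq> \<D>" "UNIV \<subseteq> \<Union>\<F>"
    using compact_space_config_topology[where 'a = 'a]
    unfolding compact_space_alt topspace_config_topology by metis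
  obtain X where X: "finite X" "\<F> = (\<lambda>x. cylinder (J x) x) ` X"
    using finite_subset_image[OF F(1) F(2)[unfolded \<D>_def]] by metis
  obtain k where k: "(\<Union>x\<in>X. J x) \<subseteq> square (int k)"
    using finite_subset_square[of "\<Union>x\<in>X. J x"] X(1) J(1) by auto
  have "refines (cylinders (square (int k))) \<C>"
    unfolding refines_def
  proof
    fix S :: "'a config set" assume "S \<in> cylinders (square (int k))"
    then obtain z where S: "S = cylinder (square (int k)) z" by (rule rangeE)
    have "z \<in> \<Union>((\<lambda>x. cylinder (J x) x) ` X)" using F(3) UNIV_I unfolding X(2) by (rule subsetD)
    then obtain x where x: "x \<in> X" "z \<in> cylinder (J x) x" by (rule UN_E)
    obtain U where U: "U \<in> \<C>" "cylinder (J x) x \<subseteq> U" using J(2) by (metis)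
    have "J x \<subseteq> square (int k)" using k x(1) by (rule UN_subset_iff[THEN iffD1, THEN bspec])
    then have "S \<subseteq> cylinder (J x) x" using x(2) unfolding S by (auto simp: mem_cylinder subset_iff)
    then have "S \<subseteq> U" using U(2) by (rule subset_trans)
    then show "\<exists>U\<in>\<C>. S \<subseteq> U" using U(1) by (rule bexI)
  qed
  then show ?thesis by (rule that)
qed

subsection \<open>Independence of the frame width\<close>

lemma is_radius_square_eq:
  assumes "is_radius F r" and "\<And>u. u \<in> square (int m) \<Longrightarrow> x u = y u"
    and "z \<in> square (int m - int r)"
  shows "F x z = F y z"
proof -
  obtain f where f: "\<And>x z. F x z = f (restrict (\<lambda>u. x (z + u)) (square (int r)))"
    using assms(1) unfolding is_radius_def by blast
  have "z + u \<in> square (int m)" if "u \<in> square (int r)" for u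
    using that assms(3) unfolding square_def by (cases u; cases z) auto
  then have "restrict (\<lambda>u. x (z + u)) (square (int r)) = restrict (\<lambda>u. y (z + u)) (square (int r))"
    using assms(2) by (intro restrict_ext) auto
  then show ?thesis using f by metis
qed

text \<open>The additive constant is the entropy of the square partition at time 0. For m < r the
  inner square is empty and the frame is the full square, so every m is covered.\<close>

lemma entropy_square_le_frame:
  fixes F :: "'a::finite config \<Rightarrow> 'a config"
  assumes "is_radius F r"
  shows "entropy_of_cover_map (cylinders (square (int m))) F
    \<le> entropy_of_cover_map (cylinders (frame r m)) F"
proof (rule entropy_of_cover_map_le)
  have "finite (square (int m))" unfolding square_def by simp
  then show fin: "finite_cover (cylinders (square (int m)) :: 'a config set set)"
    "finite_cover (cylinders (frame r m) :: 'a config set set)"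
    by (simp_all add: finite_cover_cylinders finite_frame)
  fix N
  show "cover_entropy (orbit_join (cylinders (square (int m))) F N)
    \<le> cover_entropy (cylinders (square (int m)) :: 'a config set set)
      + cover_entropy (orbit_join (cylinders (frame r m)) F N)"
  proof (rule cover_entropy_add)
    fix U V :: "'a config set"
    assume U: "U \<in> cylinders (square (int m))" and V: "V \<in> orbit_join (cylinders (frame r m)) F N"
    show "\<exists>W\<in>orbit_join (cylinders (square (int m))) F N. U \<inter> V \<subseteq> W"
    proof -
      obtain s where s: "\<forall>i\<in>{..<N}. s i \<in> (-`) (F ^^ i) ` cylinders (frame r m)"
        "V = (\<Inter>i\<in>{..<N}. s i)"
        using V by (rule cover_join_memE)
      have frame: "(F ^^ i) x u = (F ^^ i) y u"
        if "i < N" "x \<in> V" "y \<in> V" "u \<in> frame r m" for i x y u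
      proof -
        have i: "i \<in> {..<N}" using that(1) by simp
        obtain z where z: "s i = (F ^^ i) -` cylinder (frame r m) z"
          using bspec[OF s(1) i] by (metis imageE)
        have "x \<in> s i" "y \<in> s i" using that(2,3) i unfolding s(2) by simp_all
        then show ?thesis using that(4) by (simp add: z mem_cylinder)
      qed
      \<comment> \<open>Induction on time: at time i + 1 a symbol on the frame is fixed by
        \<open>V\<close>, while one in the inner square is computed by the local rule from the
        square at time i.\<close>
      have square: "(F ^^ i) x u = (F ^^ i) y u"
        if "i < N" "x \<in> U \<inter> V" "y \<in> U \<inter> V" "u \<in> square (int m)" for i x y u
        using that(1,4)
      proof (induction i arbitrary: u)
        case 0
        obtain z where "U = cylinder (square (int m)) z" using U by (rule rangeE)
        then show ?case using 0 that(2,3) by (simp add: mem_cylinder)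
      next
        case (Suc i)
        show ?case
        proof (cases "u \<in> frame r m")
          case True
          then show ?thesis using frame[of "Suc i"] Suc.prems that by blast
        next
          case False
          then have "u \<in> square (int m - int r)" using Suc.prems unfolding frame_def by blast
          then show ?thesis
            using is_radius_square_eq[OF assms, of m "(F ^^ i) x" "(F ^^ i) y" u] Suc by simp
        qed
      qed
      \<comment> \<open>For empty \<open>U \<inter> V\<close> the junk value is harmless: any member of the join contains it.\<close>
      define x where "x = (SOME x. x \<in> U \<inter> V)"
      define t where "t i = (F ^^ i) -` cylinder (square (int m)) ((F ^^ i) x)" for i
      have "(\<Inter>i\<in>{..<N}. t i) \<in> orbit_join (cylinders (square (int m))) F N"
        unfolding t_def by (intro cover_join_memI imageI rangeI)
      moreover have "U \<inter> V \<subseteq> (\<Inter>i\<in>{..<N}. t i)"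
      proof (intro subsetI INT_I)
        fix y i assume y: "y \<in> U \<inter> V" and i: "i \<in> {..<N}"
        have "x \<in> U \<inter> V" unfolding x_def using y by (rule someI[where P = "\<lambda>x. x \<in> U \<inter> V"])
        then show "y \<in> t i" using square[OF _ y] i by (simp add: t_def mem_cylinder)
      qed
      ultimately show ?thesis by (rule bexI[rotated])
    qed
  qed (use fin finite_cover_orbit_join in auto)
qed

text \<open>The two widths enter differently: for s it is enough that the frame lies in the square,
  whereas r is a radius, so that the frame of width r controls the square. With both numbers radii,
  the rates agree.\<close>

lemma entropy_rate_le_radius:
  fixes F :: "'a::finite config \<Rightarrow> 'a config"
  assumes "is_radius F r"
  shows "entropy_rate s F \<le> entropy_rate r F"
  unfolding entropy_rate_def
proof (rule SUP_mono)
  fix \<C> :: "'a config set set" assume "\<C> \<in> {\<C>. finite \<C> \<and> open_cover \<C>}"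
  then have C: "finite_cover \<C>" "open_cover \<C>" unfolding finite_cover_def open_cover_def by auto
  obtain k where k: "refines (cylinders (square (int k))) \<C>"
    using cylinders_refine_open_cover[OF C(2)] .
  let ?P = "cylinders (square (int k)) :: 'a config set set"
  have fin_square: "finite (square (int m))" for m unfolding square_def by simp
  note fin = finite_cover_cylinders[OF fin_square] finite_cover_cylinders[OF finite_frame]
    finite_cover_frame_cover
  \<comment> \<open>The enlargement from n to n + k is undone by the last step of the chain, so both
    sides carry the same index n and are divided by the same number.\<close>
  have "entropy_of_cover_map (frame_cover s n \<C>) F \<le> entropy_of_cover_map (frame_cover r n ?P) F" for n
  proof -
    have "entropy_of_cover_map (frame_cover s n \<C>) F
        \<le> entropy_of_cover_map (cylinders (square (int (n + k)))) F"
      using refines_trans[OF cylinders_square_refines_frame_cover refines_frame_cover[OF k]]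
      by (intro entropy_of_cover_map_mono fin C)
    also have "\<dots> \<le> entropy_of_cover_map (cylinders (frame r (n + k))) F"
      using assms by (rule entropy_square_le_frame)
    also have "\<dots> \<le> entropy_of_cover_map (frame_cover r n ?P) F"
      by (intro entropy_of_cover_map_mono fin frame_cover_refines_cylinders_frame)
    finally show ?thesis .
  qed
  then have "cover_entropy_rate s \<C> F \<le> cover_entropy_rate r ?P F"
    unfolding cover_entropy_rate_def by (intro Limsup_mono always_eventually) (simp add: divide_right_mono)
  moreover have "?P \<in> {\<C>. finite \<C> \<and> open_cover \<C>}"
    using fin(1)[of k] open_cover_cylinders[OF fin_square] unfolding finite_cover_def by blast
  ultimately show "\<exists>\<D>\<in>{\<C>. finite \<C> \<and> open_cover \<C>}. cover_entropy_rate s \<C> F \<le> cover_entropy_rate r \<D> F"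
    by blast
qed

subsection \<open>Factor maps\<close>

text \<open>Pulled-back covers are among the open covers of the domain and have the same rate, so
  the supremum for \<open>F\<close> at width s is at least that for \<open>G\<close>. The change of
  width is then made on the side of \<open>F\<close>, where r is a radius.\<close>

lemma entropy_rate_factor_le:
  fixes F :: "'a::finite config \<Rightarrow> 'a config" and G :: "'b config \<Rightarrow> 'b config"
  assumes "is_radius F r" "sliding_block_code \<phi>" "surj \<phi>" "\<phi> \<circ> F = G \<circ> \<phi>"
  shows "entropy_rate s G \<le> entropy_rate r F"
proof -
  have "entropy_rate s G \<le> entropy_rate s F"
    unfolding entropy_rate_def
  proof (rule SUP_mono)
    fix \<C> :: "'b config set set" assume "\<C> \<in> {\<C>. finite \<C> \<and> open_cover \<C>}"
    then have C: "finite_cover \<C>" "open_cover \<C>" unfolding finite_cover_def open_cover_def by auto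
    have cont: "continuous_map config_topology config_topology \<phi>"
      and comm: "\<And>v. \<phi> \<circ> shift v = shift v \<circ> \<phi>"
      using assms(2) unfolding sliding_block_code_def by auto
    have "openin config_topology (\<phi> -` U)" if "U \<in> \<C>" for U
      using openin_continuous_map_preimage[OF cont, of U] that C(2)
      unfolding open_cover_def by (simp add: vimage_def)
    then have "(-`) \<phi> ` \<C> \<in> {\<C>. finite \<C> \<and> open_cover \<C>}"
      using finite_cover_vimage[OF C(1), of \<phi>] unfolding finite_cover_def open_cover_def by auto
    moreover have "cover_entropy_rate s \<C> G = cover_entropy_rate s ((-`) \<phi> ` \<C>) F"
      unfolding cover_entropy_rate_def vimage_frame_cover[OF comm]
        entropy_of_cover_map_vimage[OF finite_cover_frame_cover[OF C(1)] assms(3,4)] ..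
    ultimately show "\<exists>\<D>\<in>{\<C>. finite \<C> \<and> open_cover \<C>}. cover_entropy_rate s \<C> G \<le> cover_entropy_rate s \<D> F"
      by (intro bexI[of _ "(-`) \<phi> ` \<C>"]) simp_all
  qed
  also have "\<dots> \<le> entropy_rate r F" using assms(1) by (rule entropy_rate_le_radius)
  finally show ?thesis .
qed

text \<open>A continuous bijection from a compact space to a Hausdorff space is a homeomorphism;
  commutation with shifts is inherited by applying \<phi> to both sides.\<close>

lemma sliding_block_code_inv:
  fixes \<phi> :: "'a::finite config \<Rightarrow> 'b config"
  assumes "sliding_block_code \<phi>" "bij \<phi>"
  shows "sliding_block_code (inv \<phi>)"
  unfolding sliding_block_code_def
proof (intro conjI allI)
  have cont: "continuous_map config_topology config_topology \<phi>"
    and comm: "\<And>v. \<phi> \<circ> shift v = shift v \<circ> \<phi>"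
    using assms(1) unfolding sliding_block_code_def by auto
  have "homeomorphic_map config_topology config_topology \<phi>"
    using assms(2) cont
    by (intro continuous_imp_homeomorphic_map compact_space_config_topology Hausdorff_space_config_topology)
      (auto simp: bij_is_inj bij_is_surj)
  then obtain \<psi> where \<psi>: "homeomorphic_maps config_topology config_topology \<phi> \<psi>"
    by (auto simp: homeomorphic_map_maps)
  then have "inv \<phi> = \<psi>"
    unfolding homeomorphic_maps_def by (intro inv_equality) auto
  then show "continuous_map config_topology config_topology (inv \<phi>)"
    using \<psi> unfolding homeomorphic_maps_def by simp
  fix v
  show "inv \<phi> \<circ> shift v = shift v \<circ> inv \<phi>"
  proof
    fix y
    have "\<phi> (shift v (inv \<phi> y)) = shift v y"
      using comm[of v] assms(2) by (metis bij_inv_eq_iff comp_apply)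
    then show "(inv \<phi> \<circ> shift v) y = (shift v \<circ> inv \<phi>) y"
      using assms(2) by (metis bij_inv_eq_iff comp_apply)
  qed
qed

theorem proposition15:
  fixes F :: "'a::finite config \<Rightarrow> 'a config"
    and G :: "'b::finite config \<Rightarrow> 'b config"
    and \<phi> :: "'a config \<Rightarrow> 'b config"
    and r s :: nat
  assumes "cellular_automaton F" and "is_radius F r"
    and "cellular_automaton G" and "is_radius G s"
    and "sliding_block_code \<phi>"
    and "\<phi> \<circ> F = G \<circ> \<phi>"
  shows "(surj \<phi> \<longrightarrow> entropy_rate r F \<ge> entropy_rate s G) \<and>
         (bij \<phi> \<longrightarrow> entropy_rate r F = entropy_rate s G)"
proof -
  have factor: "entropy_rate s G \<le> entropy_rate r F" if "surj \<phi>"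
    using assms(2,5) that assms(6) by (rule entropy_rate_factor_le)
  \<comment> \<open>The factor inequality is applied to \<open>inv \<phi>\<close>, with the automata
    and their radii exchanged.\<close>
  moreover have "entropy_rate r F \<le> entropy_rate s G" if bij: "bij \<phi>"
  proof (rule entropy_rate_factor_le[OF assms(4)])
    show "sliding_block_code (inv \<phi>)" using assms(5) bij by (rule sliding_block_code_inv)
    show "surj (inv \<phi>)" using bij by (simp add: bij_imp_bij_inv bij_is_surj)
    show "inv \<phi> \<circ> G = F \<circ> inv \<phi>"
    proof
      fix y
      have "\<phi> (F (inv \<phi> y)) = G y"
        using assms(6) bij by (metis bij_inv_eq_iff comp_apply)
      then show "(inv \<phi> \<circ> G) y = (F \<circ> inv \<phi>) y"
        using bij by (metis bij_inv_eq_iff comp_apply)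
    qed
  qed
  ultimately show ?thesis using bij_is_surj by (auto intro: antisym)
qed

end
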